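(* Let $r>1$ and let $U=(u_{ij})_{i,j\in\mathbb{Z}}$ be a matrix of $r\times r$ blocks depending on $\boldsymbol{x}=(x_0,x_1,\ldots)$ and $\boldsymbol{y}=(y_0,y_1,\ldots)$ that satisfies, for $k=1,2,\ldots$, $$\frac{\partial U}{\partial x_k}=\bigl(E_r\otimes\Lambda-U(E_r\otimes\mathcal{O}_1)\bigr)\frac{\partial U}{\partial x_{k-1}},\qquad \frac{\partial U}{\partial y_k}=\bigl(E_r\otimes\Lambda-U(E_r\otimes\mathcal{O}_1)\bigr)\frac{\partial U}{\partial y_{k-1}},$$ together with the constraint $(E_r\otimes\Lambda)U-U(E_r\otimes\Lambda^{-1})-U(E_r\otimes\mathcal{O}_1)U=0$. Then $g=E-U(E_r\otimes\Omega)$ and $\bar g=E-U(E_r\otimes\bar\Omega)$ satisfy, for $k=1,2,\ldots$, $$\frac{\partial g}{\partial x_k}=\bigl(E_r\otimes\Lambda-U(E_r\otimes\mathcal{O}_1)\bigr)\frac{\partial g}{\partial x_{k-1}},\qquad \frac{\partial g}{\partial y_k}=\bigl(E_r\otimes\Lambda-U(E_r\otimes\mathcal{O}_1)\bigr)\frac{\partial g}{\partial y_{k-1}},$$ $$\frac{\partial\bar g}{\partial x_k}=\bigl(E_r\otimes\Lambda-U(E_r\otimes\mathcal{O}_1)\bigr)\frac{\partial\bar g}{\partial x_{k-1}},\qquad \frac{\partial\bar g}{\partial y_k}=\bigl(E_r\otimes\Lambda-U(E_r\otimes\mathcal{O}_1)\bigr)\frac{\partial\bar g}{\partial y_{k-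1}}.$$
   Context: $E_{ij}$ denotes the scalar $\mathbb{Z}\times\mathbb{Z}$ matrix unit, $E_r$ the $r\times r$ unit matrix, and $E$ the unit matrix with $r\times r$ blocks $\delta_{ij}E_r$. $\Lambda^{k}=\sum_{i\in\mathbb{Z}}E_{i,i+k}$, $\Lambda=\Lambda^1$, $\mathcal{O}_1=E_{0,0}$, $\Omega=\sum_{i=0}^\infty E_{i,-i-1}$, $\bar\Omega=-\sum_{i=0}^\infty E_{-i-1,i}$. For an $r\times r$ matrix $A$ and a scalar $\mathbb{Z}\times\mathbb{Z}$ matrix $B=(b_{ij})$, $A\otimes B$ is the block matrix with $(i,j)$ block $b_{ij}A$, so that $(A\otimes B)U=\bigl(\sum_kb_{ik}Au_{kj}\bigr)_{ij}$ and $U(A\otimes B)=\bigl(\sum_ku_{ik}Ab_{kj}\bigr)_{ij}$. *)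

theory Defs
  imports "HOL-Analysis.Analysis" "HOL-Library.Groups_Big_Fun"
begin

type_synonym 'k imat = "int \<Rightarrow> int \<Rightarrow> 'k"
type_synonym ('k, 'r) bmat = "int \<Rightarrow> int \<Rightarrow> 'k^'r^'r"

text \<open>
  Block matrices depending on two sequences of variables. The scalar field \<open>'k\<close> is the type of
  both the variables and the matrix entries; real and complex numbers are both instances.
\<close>

type_synonym ('k, 'r) bfield = "(nat \<Rightarrow> 'k) \<Rightarrow> (nat \<Rightarrow> 'k) \<Rightarrow> ('k, 'r) bmat"

definition munit :: "int \<Rightarrow> int \<Rightarrow> 'k::zero_neq_one imat" where
  "munit i j = (\<lambda>m n. if m = i \<and> n = j then 1 else 0)"

text \<open>
  The infinite sums of matrix units are taken entrywise; at each position at most one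
  summand is nonzero. \<open>Lambda k\<close> is the \<open>k\<close>-th power of the shift, \<open>k\<close> any integer.
\<close>

definition Lambda :: "int \<Rightarrow> 'k::comm_ring_1 imat" where
  "Lambda k = (\<lambda>m n. Sum_any (\<lambda>i::int. munit i (i + k) m n))"

definition O1 :: "'k::comm_ring_1 imat" where
  "O1 = munit 0 0"

definition Omega :: "'k::comm_ring_1 imat" where
  "Omega = (\<lambda>m n. Sum_any (\<lambda>i::nat. munit (int i) (- int i - 1) m n))"

definition Omega_bar :: "'k::comm_ring_1 imat" where
  "Omega_bar = (\<lambda>m n. - Sum_any (\<lambda>i::nat. munit (- int i - 1) (int i) m n))"

lemma Sum_any_unique: "Sum_any (\<lambda>i. if i = a \<and> P then c else 0) = (if P then c else 0)"
  by (cases P) (simp_all add: Sum_any.delta)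

lemma Lambda_apply: "(Lambda k m n :: 'k::comm_ring_1) = (if n = m + k then 1 else 0)"
proof -
  have "(munit i (i + k) m n :: 'k) = (if i = m \<and> n = m + k then 1 else 0)" for i
    by (auto simp: munit_def)
  then show ?thesis by (simp add: Lambda_def Sum_any_unique)
qed

lemma Omega_apply: "(Omega m n :: 'k::comm_ring_1) = (if 0 \<le> m \<and> n = - m - 1 then 1 else 0)"
proof -
  have "(munit (int i) (- int i - 1) m n :: 'k) = (if i = nat m \<and> (0 \<le> m \<and> n = - m - 1) then 1 else 0)" for i
    by (auto simp: munit_def)
  then show ?thesis by (simp only: Omega_def Sum_any_unique)
qed

lemma Omega_bar_apply: "(Omega_bar m n :: 'k::comm_ring_1) = (if 0 \<le> n \<and> m = - n - 1 then - 1 else 0)"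
proof -
  have "(munit (- int i - 1) (int i) m n :: 'k) = (if i = nat n \<and> (0 \<le> n \<and> m = - n - 1) then 1 else 0)" for i
    by (auto simp: munit_def)
  then show ?thesis by (simp only: Omega_bar_def Sum_any_unique) simp
qed

definition btensor :: "'k::comm_ring_1^'r::finite^'r \<Rightarrow> 'k imat \<Rightarrow> ('k, 'r::finite) bmat"
    (infixl \<open>\<otimes>\<^sub>B\<close> 75) where
  "A \<otimes>\<^sub>B B = (\<lambda>i j. \<chi> a b. B i j * A $ a $ b)"

definition bmat_one :: "('k::comm_ring_1, 'r::finite) bmat" where
  "bmat_one = (\<lambda>i j. if i = j then mat 1 else 0)"

text \<open>
  The sum runs over all integers and is meaningful when only finitely many terms are nonzero,
  for instance when the left factor is row-finite or the right factor is column-finite.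
\<close>

definition bmult :: "('k::comm_ring_1, 'r::finite) bmat \<Rightarrow> ('k, 'r) bmat \<Rightarrow> ('k, 'r) bmat"
    (infixl \<open>\<odot>\<close> 70) where
  "M \<odot> N = (\<lambda>i j. Sum_any (\<lambda>k. M i k ** N k j))"

definition dx :: "nat \<Rightarrow> ('k::real_normed_field, 'r::finite) bfield \<Rightarrow> ('k, 'r) bfield" where
  "dx k M = (\<lambda>x y i j. \<chi> a b. deriv (\<lambda>t. M (x(k := t)) y i j $ a $ b) (x k))"

definition dy :: "nat \<Rightarrow> ('k::real_normed_field, 'r::finite) bfield \<Rightarrow> ('k, 'r) bfield" where
  "dy k M = (\<lambda>x y i j. \<chi> a b. deriv (\<lambda>t. M x (y(k := t)) i j $ a $ b) (y k))"

text \<open>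
  Existence of all first partial derivatives of all entries. Needed explicitly because
  \<open>deriv\<close> is total.
\<close>

definition partially_differentiable_on ::
    "('k::real_normed_field, 'r::finite) bfield \<Rightarrow> ((nat \<Rightarrow> 'k) \<times> (nat \<Rightarrow> 'k)) set \<Rightarrow> bool"
    (infix \<open>partially'_differentiable'_on\<close> 50) where
  "M partially_differentiable_on D \<longleftrightarrow>
     (\<forall>(x, y) \<in> D. \<forall>k i j a b.
        (\<lambda>t. M (x(k := t)) y i j $ a $ b) field_differentiable at (x k) \<and>
        (\<lambda>t. M x (y(k := t)) i j $ a $ b) field_differentiable at (y k))"

text \<open>
  Openness in each variable separately, which is what makes partial derivatives at points of
  \<open>D\<close> depend only on values in \<open>D\<close>. It is weaker than openness in the product topology,
  where all but finitely many variables would be unrestricted, and so also admits, for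
  example, the summable sequences.
\<close>

definition coordinatewise_open ::
    "((nat \<Rightarrow> 'k::topological_space) \<times> (nat \<Rightarrow> 'k)) set \<Rightarrow> bool" where
  "coordinatewise_open D \<longleftrightarrow>
     (\<forall>x y k. open {t. (x(k := t), y) \<in> D} \<and> open {t. (x, y(k := t)) \<in> D})"

end

(* Left multiplication acts on each column separately. Every column of Omega and Omega_bar has at
   most one nonzero entry, so every column of a derivative of g or g_bar is a scalar multiple of a
   column of the same derivative of U, and the linear recursion carries over column by column. *)
theory Submission
  imports Defs
begin

text \<open>Closed form of right multiplication by a scalar matrix whose column \<open>j\<close> has
  at most one nonzero entry, \<open>c j\<close> in row \<open>s j\<close>. No infinite sum is left
  in it.\<close>

definition scale_columns ::
    "(int \<Rightarrow> int) \<Rightarrow> (int \<Rightarrow> 'k) \<Rightarrow> ('k::comm_ring_1, 'r::finite) bmat \<Rightarrow> ('k, 'r) bmat" where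
  "scale_columns s c N = (\<lambda>i j. \<chi> a b. c j * N i (s j) $ a $ b)"

text \<open>The delicate case is an infinite support, where \<open>Sum_any\<close> returns 0:
  scaling must not turn such a sum into a nonzero finite one. In a field every factor is zero or
  invertible, which rules this out.\<close>

lemma bmult_scale_columns:
  fixes L N :: "('k::field, 'r::finite) bmat"
  shows "L \<odot> scale_columns s c N = scale_columns s c (L \<odot> N)"
proof (intro ext)
  fix i j
  let ?h = "\<lambda>X::'k^'r^'r. (\<chi> a b. c j * X $ a $ b) :: 'k^'r^'r"
  have h: "L i k ** scale_columns s c N k j = ?h (L i k ** N k (s j))" for k
    by (simp add: vec_eq_iff matrix_matrix_mult_def scale_columns_def sum_distrib_left mult_ac)
  have h_sum: "(\<Sum>k\<in>K. ?h (f k)) = ?h (sum f K)" for f and K :: "int set"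
    by (simp add: vec_eq_iff sum_distrib_left)
  have "Sum_any (\<lambda>k. ?h (L i k ** N k (s j))) = ?h (Sum_any (\<lambda>k. L i k ** N k (s j)))"
  \<comment> \<open>A nonzero factor preserves the support, so both sums are finite or both default
    to 0. A zero factor makes every summand on the left and the whole right side vanish.\<close>
  proof (cases "c j = 0")
    case True
    then have "?h X = 0" for X by (simp add: vec_eq_iff)
    then show ?thesis by simp
  next
    case False
    then have "?h X = 0 \<longleftrightarrow> X = 0" for X by (simp add: vec_eq_iff)
    then show ?thesis by (simp add: Sum_any.expand_set h_sum)
  qed
  then show "(L \<odot> scale_columns s c N) i j = scale_columns s c (L \<odot> N) i j"
    unfolding bmult_def h by (simp add: scale_columns_def)
qed

text \<open>Only the summand \<open>k = s j\<close> can survive, so the sum over all integers is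
  finite for arbitrary \<open>M\<close>.\<close>

lemma bmult_btensor_monomial:
  fixes M :: "('k::comm_ring_1, 'r::finite) bmat"
  assumes "\<And>k j. k \<noteq> s j \<Longrightarrow> B k j = 0"
  shows "M \<odot> (mat 1 \<otimes>\<^sub>B B) = scale_columns s (\<lambda>j. B (s j) j) M"
proof (intro ext)
  fix i j
  have scalar: "M i k ** (mat 1 \<otimes>\<^sub>B B) k j = (\<chi> a b. B k j * M i k $ a $ b)" for k
    by (simp add: vec_eq_iff matrix_matrix_mult_def btensor_def mat_def if_distrib
      sum.delta mult.commute cong: if_cong)
  have "M i k ** (mat 1 \<otimes>\<^sub>B B) k j
      = (if k = s j then (\<chi> a b. B (s j) j * M i (s j) $ a $ b) else 0)" for k
    using assms[of k j] by (simp add: scalar vec_eq_iff)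
  then show "(M \<odot> (mat 1 \<otimes>\<^sub>B B)) i j = scale_columns s (\<lambda>j. B (s j) j) M i j"
    by (simp add: bmult_def scale_columns_def Sum_any.delta)
qed

context
  fixes U G :: "('k::real_normed_field, 'r::finite) bfield"
    and C :: "('k, 'r) bmat"
    and D s c
  assumes U: "U partially_differentiable_on D"
    and G: "G = (\<lambda>x y. C - scale_columns s c (U x y))"
begin

lemma entry_diff_scale_columns:
  "G x y i j $ a $ b = C i j $ a $ b - c j * U x y i (s j) $ a $ b"
  by (simp add: G scale_columns_def)

lemma partially_differentiable_diff_scale_columns: "G partially_differentiable_on D"
  using U unfolding partially_differentiable_on_def entry_diff_scale_columns
  by (fastforce intro!: derivative_intros)

text \<open>\<open>C\<close> is constant and each entry of \<open>G\<close> involves a single entry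
  of \<open>U\<close>, so no derivative has to pass through an infinite sum. The minus sign is
  absorbed into the coefficients to obtain a column scaling again, as
  \<open>bmult_scale_columns\<close> expects.\<close>

lemma dx_diff_scale_columns:
  assumes "(x, y) \<in> D"
  shows "dx k G x y = scale_columns s (\<lambda>j. - c j) (dx k U x y)"
proof -
  have "(\<lambda>t. U (x(k := t)) y i j $ a $ b) field_differentiable at (x k)" for i j a b
    using U assms unfolding partially_differentiable_on_def by blast
  then show ?thesis
    unfolding dx_def scale_columns_def entry_diff_scale_columns
    by (simp add: fun_eq_iff vec_eq_iff deriv_diff deriv_cmult field_differentiable_const
      field_differentiable_mult)
qed

lemma dy_diff_scale_columns:
  assumes "(x, y) \<in> D"
  shows "dy k G x y = scale_columns s (\<lambda>j. - c j) (dy k U x y)"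
proof -
  have "(\<lambda>t. U x (y(k := t)) i j $ a $ b) field_differentiable at (y k)" for i j a b
    using U assms unfolding partially_differentiable_on_def by blast
  then show ?thesis
    unfolding dy_def scale_columns_def entry_diff_scale_columns
    by (simp add: fun_eq_iff vec_eq_iff deriv_diff deriv_cmult field_differentiable_const
      field_differentiable_mult)
qed

end

theorem proposition13:
  fixes U g g_bar :: "('k::real_normed_field, 'r::finite) bfield"
    and D :: "((nat \<Rightarrow> 'k) \<times> (nat \<Rightarrow> 'k)) set"
  assumes r: "CARD('r) > 1"
    and D: "coordinatewise_open D"
    and U_diff: "U partially_differentiable_on D"
    and U_x: "\<And>k x y. k \<ge> 1 \<Longrightarrow> (x, y) \<in> D \<Longrightarrow>
      dx k U x y = (mat 1 \<otimes>\<^sub>B Lambda 1 - U x y \<odot> (mat 1 \<otimes>\<^sub>B O1)) \<odot> dx (k - 1) U x y"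
    and U_y: "\<And>k x y. k \<ge> 1 \<Longrightarrow> (x, y) \<in> D \<Longrightarrow>
      dy k U x y = (mat 1 \<otimes>\<^sub>B Lambda 1 - U x y \<odot> (mat 1 \<otimes>\<^sub>B O1)) \<odot> dy (k - 1) U x y"
    and U_constraint: "\<And>x y. (x, y) \<in> D \<Longrightarrow>
      (mat 1 \<otimes>\<^sub>B Lambda 1) \<odot> U x y - U x y \<odot> (mat 1 \<otimes>\<^sub>B Lambda (-1))
        - U x y \<odot> (mat 1 \<otimes>\<^sub>B O1) \<odot> U x y = (\<lambda>i j. 0)"
    and g: "g = (\<lambda>x y. bmat_one - U x y \<odot> (mat 1 \<otimes>\<^sub>B Omega))"
    and g_bar: "g_bar = (\<lambda>x y. bmat_one - U x y \<odot> (mat 1 \<otimes>\<^sub>B Omega_bar))"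
  shows "g partially_differentiable_on D \<and> g_bar partially_differentiable_on D \<and>
    (\<forall>k\<ge>1. \<forall>(x, y) \<in> D.
      dx k g x y = (mat 1 \<otimes>\<^sub>B Lambda 1 - U x y \<odot> (mat 1 \<otimes>\<^sub>B O1)) \<odot> dx (k - 1) g x y \<and>
      dy k g x y = (mat 1 \<otimes>\<^sub>B Lambda 1 - U x y \<odot> (mat 1 \<otimes>\<^sub>B O1)) \<odot> dy (k - 1) g x y \<and>
      dx k g_bar x y = (mat 1 \<otimes>\<^sub>B Lambda 1 - U x y \<odot> (mat 1 \<otimes>\<^sub>B O1)) \<odot> dx (k - 1) g_bar x y \<and>
      dy k g_bar x y = (mat 1 \<otimes>\<^sub>B Lambda 1 - U x y \<odot> (mat 1 \<otimes>\<^sub>B O1)) \<odot> dy (k - 1) g_bar x y)"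
proof -
  \<comment> \<open>The units in \<open>Omega\<close> lie on the antidiagonal
    \<open>m + n = -1\<close>, hence the row \<open>- j - 1\<close>. The coefficient is 1 for
    \<open>j < 0\<close> and 0 otherwise.\<close>
  have "U x y \<odot> (mat 1 \<otimes>\<^sub>B Omega)
      = scale_columns (\<lambda>j. - j - 1) (\<lambda>j. Omega (- j - 1) j) (U x y)" for x y
    by (rule bmult_btensor_monomial) (auto simp: Omega_apply)
  with g have g: "g = (\<lambda>x y. bmat_one
      - scale_columns (\<lambda>j. - j - 1) (\<lambda>j. Omega (- j - 1) j) (U x y))"
    by simp
  \<comment> \<open>This is the other half of the same antidiagonal: the coefficient is -1 for
    \<open>j \<ge> 0\<close> and 0 otherwise.\<close>
  have "U x y \<odot> (mat 1 \<otimes>\<^sub>B Omega_bar)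
      = scale_columns (\<lambda>j. - j - 1) (\<lambda>j. Omega_bar (- j - 1) j) (U x y)" for x y
    by (rule bmult_btensor_monomial) (auto simp: Omega_bar_apply)
  with g_bar have g_bar: "g_bar = (\<lambda>x y. bmat_one
      - scale_columns (\<lambda>j. - j - 1) (\<lambda>j. Omega_bar (- j - 1) j) (U x y))"
    by simp
  note dx_eq = dx_diff_scale_columns[OF U_diff g] dx_diff_scale_columns[OF U_diff g_bar]
  note dy_eq = dy_diff_scale_columns[OF U_diff g] dy_diff_scale_columns[OF U_diff g_bar]
  \<comment> \<open>Both sides of each recursion become the same column scaling, applied to the two
    sides of the recursion for \<open>U\<close>. As \<open>1 \<le> k\<close> does not give
    \<open>1 \<le> k - 1\<close>, rewriting with \<open>U_x\<close> and \<open>U_y\<close> stops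
    after one step.\<close>
  show ?thesis
    using partially_differentiable_diff_scale_columns[OF U_diff g]
      partially_differentiable_diff_scale_columns[OF U_diff g_bar]
    by (auto simp: dx_eq dy_eq bmult_scale_columns U_x U_y simp del: One_nat_def)
qed

end
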